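(* For every $\mathcal F\in\beta\mathbb N$ the following conditions are equivalent: (i) the $=_\sim$-equivalence class $[\mathcal F]$ is a singleton; (ii) there are no distinct generators $x$ and $y$ of $\mathcal F$ such that $x\,{}^*\!\!\mid y$; (iii) there is a set $A\in\mathcal F$ which is an antichain for divisibility (no two distinct elements of $A$ divide one another).
   Context: $\mathbb N=\{1,2,3,\dots\}$; $\beta\mathbb N$ is the set of ultrafilters on $\mathbb N$, with $n\in\mathbb N$ identified with the principal ultrafilter at $n$. For $A\subseteq\mathbb N$ let $A\uparrow=\{n\in\mathbb N:(\exists a\in A)\,a\mid n\}$, and $\mathcal U=\{A\subseteq\mathbb N: A\ne\emptyset,\ A=A\uparrow\}$. For $\mathcal F,\mathcal G\in\beta\mathbb N$: $\mathcal F\,\widetilde{\mid}\,\mathcal G$ iff $\mathcal F\cap\mathcal U\subseteq\mathcal G$; $\mathcal F=_\sim\mathcal G$ iff $\mathcal F\,\widetilde{\mid}\,\mathcal G$ and $\mathcal G\,\widetilde{\mid}\,\mathcal F$; $[\mathcal F]$ is the $=_\sim$-equivalence class of $\mathcal F$. Standing assumption: we work in a fixed nonstandard extension ${}^*$ (of a superstructure over $\mathbb N$) which is $\mathfrak c^+$-saturated and satisfies Henson's isomorphism property (any two elementarily equivalent internally presented structures, for a finite first-order language, are isomorphic). For $x\in{}^*\mathbb N$, $tp(x/\mathbb N)=\{A\subseteq\mathbb N:x\in{}^*A\}\in\beta\mathbb N$; $x$ is a generator of $\mathcal F$ if $tp(x/\mathbb N)=\mathcal F$. ${}^*\!\mid$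 is the extension of the divisibility relation $\mid$ to ${}^*\mathbb N$. *)

theory Defs
  imports Complex_Main "HOL-Library.Equipollence"
begin

section \<open>Ultrafilters on the positive integers and extended divisibility\<close>

text \<open>The positive integers are the subset \<open>{1..}\<close> of \<^typ>\<open>nat\<close>. An ultrafilter on
  them is the set of its members.\<close>

definition pos_nats :: "nat set" where
  "pos_nats = {1..}"

definition ultrafilters :: "nat set set set" where
  "ultrafilters = {F. F \<subseteq> Pow pos_nats \<and> pos_nats \<in> F \<and> {} \<notin> F
     \<and> (\<forall>A\<in>F. \<forall>B\<in>F. A \<inter> B \<in> F)
     \<and> (\<forall>A\<in>F. \<forall>B. A \<subseteq> B \<and> B \<subseteq> pos_nats \<longrightarrow> B \<in> F)
     \<and> (\<forall>A. A \<subseteq> pos_nats \<longrightarrow> A \<in> F \<or> pos_nats - A \<in> F)}"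

definition up_closure :: "nat set \<Rightarrow> nat set" where
  "up_closure A = {n \<in> pos_nats. \<exists>a\<in>A. a dvd n}"

definition up_sets :: "nat set set" where
  "up_sets = {A. A \<subseteq> pos_nats \<and> A \<noteq> {} \<and> A = up_closure A}"

definition tilde_dvd :: "nat set set \<Rightarrow> nat set set \<Rightarrow> bool" where
  "tilde_dvd F G \<longleftrightarrow> F \<inter> up_sets \<subseteq> G"

definition tilde_eq :: "nat set set \<Rightarrow> nat set set \<Rightarrow> bool" where
  "tilde_eq F G \<longleftrightarrow> tilde_dvd F G \<and> tilde_dvd G F"

definition tilde_class :: "nat set set \<Rightarrow> nat set set set" where
  "tilde_class F = {G \<in> ultrafilters. tilde_eq F G}"

definition dvd_antichain :: "nat set \<Rightarrow> bool" where
  "dvd_antichain A \<longleftrightarrow> (\<forall>a\<in>A. \<forall>b\<in>A. a \<noteq> b \<longrightarrow> \<not> a dvd b)"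


section \<open>Superstructures\<close>

text \<open>A superstructure over a base set cannot be built as a HOL type for an arbitrary base,
  so it is described (up to isomorphism, uniquely) by a base set of atoms inside some type and
  a function sending each object to the set of its elements. Only objects occurring in some
  level count; anything else in the type is ignored.\<close>

record 'a sstruct =
  atoms :: "'a set"
  elems :: "'a \<Rightarrow> 'a set"

primrec level :: "'a sstruct \<Rightarrow> nat \<Rightarrow> 'a set" where
  "level V 0 = atoms V"
| "level V (Suc n) = level V n \<union> {s. s \<notin> atoms V \<and> elems V s \<subseteq> level V n}"

definition objects :: "'a sstruct \<Rightarrow> 'a set" where
  "objects V = (\<Union>n. level V n)"

definition sets_of :: "'a sstruct \<Rightarrow> 'a set" where
  "sets_of V = objects V - atoms V"

text \<open>The last conjunct says that each level is followed by its full power set.\<close>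

definition superstructure :: "'a sstruct \<Rightarrow> bool" where
  "superstructure V \<longleftrightarrow>
     (\<forall>x\<in>atoms V. elems V x = {})
   \<and> inj_on (elems V) (sets_of V)
   \<and> (\<forall>n. \<forall>S. S \<subseteq> level V n \<longrightarrow> (\<exists>s. s \<notin> atoms V \<and> elems V s = S))"

text \<open>The object whose elements are exactly \<open>S\<close>; meaningful if \<open>S\<close> is contained in some level.\<close>

definition set_obj :: "'a sstruct \<Rightarrow> 'a set \<Rightarrow> 'a" where
  "set_obj V S = (THE s. s \<in> sets_of V \<and> elems V s = S)"

definition pair_obj :: "'a sstruct \<Rightarrow> 'a \<Rightarrow> 'a \<Rightarrow> 'a" where
  "pair_obj V a b = set_obj V {set_obj V {a}, set_obj V {a, b}}"

fun tuple_obj :: "'a sstruct \<Rightarrow> 'a list \<Rightarrow> 'a" where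
  "tuple_obj V [] = set_obj V {}"
| "tuple_obj V [a] = a"
| "tuple_obj V (a # b # xs) = pair_obj V a (tuple_obj V (b # xs))"


section \<open>Nonstandard extensions\<close>

text \<open>Bounded formulas of the language of set theory; variables are numbered, and
  \<open>BAll i j \<phi>\<close> stands for \<open>\<forall>v\<^sub>i \<in> v\<^sub>j. \<phi>\<close>.\<close>

datatype bformula =
    BMem nat nat
  | BEq nat nat
  | BNeg bformula
  | BConj bformula bformula
  | BAll nat nat bformula

primrec bsat :: "'a sstruct \<Rightarrow> bformula \<Rightarrow> (nat \<Rightarrow> 'a) \<Rightarrow> bool" where
  "bsat V (BMem i j) e \<longleftrightarrow> e i \<in> elems V (e j)"
| "bsat V (BEq i j) e \<longleftrightarrow> e i = e j"
| "bsat V (BNeg \<phi>) e \<longleftrightarrow> \<not> bsat V \<phi> e"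
| "bsat V (BConj \<phi> \<psi>) e \<longleftrightarrow> bsat V \<phi> e \<and> bsat V \<psi> e"
| "bsat V (BAll i j \<phi>) e \<longleftrightarrow> (\<forall>u\<in>elems V (e j). bsat V \<phi> (e(i := u)))"

text \<open>\<open>V\<close> is the superstructure over the positive integers, with \<open>\<nu> n\<close> the atom representing
  \<open>n\<close>, and \<open>W\<close> is the superstructure over their extension. The number \<open>n\<close> is
  identified with \<open>star (\<nu> n)\<close>. The conjuncts after those fixing \<open>V\<close> and \<open>W\<close> are: \<open>star\<close>
  maps \<open>V\<close> to \<open>W\<close>; the extension of the base set of \<open>V\<close> is the base set of \<open>W\<close>; the
  transfer principle; infinite sets of atoms are properly extended.\<close>

definition nonstandard_extension ::
    "'a sstruct \<Rightarrow> (nat \<Rightarrow> 'a) \<Rightarrow> 'b sstruct \<Rightarrow> ('a \<Rightarrow> 'b) \<Rightarrow> bool" where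
  "nonstandard_extension V \<nu> W star \<longleftrightarrow>
     superstructure V \<and> inj_on \<nu> pos_nats \<and> atoms V = \<nu> ` pos_nats
   \<and> superstructure W
   \<and> star ` objects V \<subseteq> objects W
   \<and> elems W (star (set_obj V (atoms V))) = atoms W
   \<and> (\<forall>\<phi> e. range e \<subseteq> objects V \<longrightarrow> (bsat V \<phi> e \<longleftrightarrow> bsat W \<phi> (star \<circ> e)))
   \<and> (\<forall>A. A \<subseteq> atoms V \<and> infinite A \<longrightarrow> star ` A \<subset> elems W (star (set_obj V A)))"

definition internal :: "'a sstruct \<Rightarrow> 'b sstruct \<Rightarrow> ('a \<Rightarrow> 'b) \<Rightarrow> 'b \<Rightarrow> bool" where
  "internal V W star u \<longleftrightarrow> (\<exists>A\<in>objects V. u \<in> elems W (star A))"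

definition internal_set :: "'a sstruct \<Rightarrow> 'b sstruct \<Rightarrow> ('a \<Rightarrow> 'b) \<Rightarrow> 'b set \<Rightarrow> bool" where
  "internal_set V W star S \<longleftrightarrow>
     (\<exists>s\<in>sets_of W. internal V W star s \<and> elems W s = S)"

text \<open>Fewer than \<open>\<cc>\<^sup>+\<close> sets means at most \<open>\<cc>\<close> sets.\<close>

definition c_plus_saturated :: "'a sstruct \<Rightarrow> 'b sstruct \<Rightarrow> ('a \<Rightarrow> 'b) \<Rightarrow> bool" where
  "c_plus_saturated V W star \<longleftrightarrow>
     (\<forall>\<S>. (\<forall>S\<in>\<S>. internal_set V W star S) \<and> \<S> \<lesssim> (UNIV :: real set)
        \<and> (\<forall>\<T>. \<T> \<subseteq> \<S> \<and> finite \<T> \<longrightarrow> \<Inter>\<T> \<noteq> {})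
        \<longrightarrow> \<Inter>\<S> \<noteq> {})"


section \<open>First-order structures and the isomorphism property\<close>

text \<open>A finite language is given by the arities of its relation symbols and of its function
  symbols (constants have arity 0); a symbol is referred to by its position in the list.\<close>

record fo_language =
  rel_arities :: "nat list"
  fun_arities :: "nat list"

datatype fo_term = Var nat | Fn nat "fo_term list"

datatype fo_formula =
    Eq fo_term fo_term
  | Rel nat "fo_term list"
  | Neg fo_formula
  | Conj fo_formula fo_formula
  | All nat fo_formula

primrec term_in :: "fo_language \<Rightarrow> fo_term \<Rightarrow> bool" where
  "term_in L (Var i) \<longleftrightarrow> True"
| "term_in L (Fn f ts) \<longleftrightarrow>
     f < length (fun_arities L) \<and> length ts = fun_arities L ! f \<and> list_all (term_in L) ts"

primrec formula_in :: "fo_language \<Rightarrow> fo_formula \<Rightarrow> bool" where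
  "formula_in L (Eq s t) \<longleftrightarrow> term_in L s \<and> term_in L t"
| "formula_in L (Rel r ts) \<longleftrightarrow>
     r < length (rel_arities L) \<and> length ts = rel_arities L ! r \<and> list_all (term_in L) ts"
| "formula_in L (Neg \<phi>) \<longleftrightarrow> formula_in L \<phi>"
| "formula_in L (Conj \<phi> \<psi>) \<longleftrightarrow> formula_in L \<phi> \<and> formula_in L \<psi>"
| "formula_in L (All i \<phi>) \<longleftrightarrow> formula_in L \<phi>"

primrec term_vars :: "fo_term \<Rightarrow> nat set" where
  "term_vars (Var i) = {i}"
| "term_vars (Fn f ts) = \<Union> (set (map term_vars ts))"

primrec free_vars :: "fo_formula \<Rightarrow> nat set" where
  "free_vars (Eq s t) = term_vars s \<union> term_vars t"
| "free_vars (Rel r ts) = (\<Union>t\<in>set ts. term_vars t)"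
| "free_vars (Neg \<phi>) = free_vars \<phi>"
| "free_vars (Conj \<phi> \<psi>) = free_vars \<phi> \<union> free_vars \<psi>"
| "free_vars (All i \<phi>) = free_vars \<phi> - {i}"

record 'a fo_structure =
  domain :: "'a set"
  rel_interp :: "nat \<Rightarrow> 'a list set"
  fun_interp :: "nat \<Rightarrow> 'a list \<Rightarrow> 'a"

definition tuples :: "'a set \<Rightarrow> nat \<Rightarrow> 'a list set" where
  "tuples D n = {xs. length xs = n \<and> set xs \<subseteq> D}"

definition fo_structure_for :: "fo_language \<Rightarrow> 'a fo_structure \<Rightarrow> bool" where
  "fo_structure_for L M \<longleftrightarrow> domain M \<noteq> {}
   \<and> (\<forall>r < length (rel_arities L). rel_interp M r \<subseteq> tuples (domain M) (rel_arities L ! r))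
   \<and> (\<forall>f < length (fun_arities L). \<forall>xs \<in> tuples (domain M) (fun_arities L ! f).
        fun_interp M f xs \<in> domain M)"

primrec term_val :: "'a fo_structure \<Rightarrow> (nat \<Rightarrow> 'a) \<Rightarrow> fo_term \<Rightarrow> 'a" where
  "term_val M e (Var i) = e i"
| "term_val M e (Fn f ts) = fun_interp M f (map (term_val M e) ts)"

primrec fo_sat :: "'a fo_structure \<Rightarrow> fo_formula \<Rightarrow> (nat \<Rightarrow> 'a) \<Rightarrow> bool" where
  "fo_sat M (Eq s t) e \<longleftrightarrow> term_val M e s = term_val M e t"
| "fo_sat M (Rel r ts) e \<longleftrightarrow> map (term_val M e) ts \<in> rel_interp M r"
| "fo_sat M (Neg \<phi>) e \<longleftrightarrow> \<not> fo_sat M \<phi> e"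
| "fo_sat M (Conj \<phi> \<psi>) e \<longleftrightarrow> fo_sat M \<phi> e \<and> fo_sat M \<psi> e"
| "fo_sat M (All i \<phi>) e \<longleftrightarrow> (\<forall>d\<in>domain M. fo_sat M \<phi> (e(i := d)))"

definition fo_true :: "'a fo_structure \<Rightarrow> fo_formula \<Rightarrow> bool" where
  "fo_true M \<phi> \<longleftrightarrow> (\<forall>e. range e \<subseteq> domain M \<longrightarrow> fo_sat M \<phi> e)"

definition elem_equiv :: "fo_language \<Rightarrow> 'a fo_structure \<Rightarrow> 'b fo_structure \<Rightarrow> bool" where
  "elem_equiv L M N \<longleftrightarrow>
     (\<forall>\<phi>. formula_in L \<phi> \<and> free_vars \<phi> = {} \<longrightarrow> (fo_true M \<phi> \<longleftrightarrow> fo_true N \<phi>))"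

definition fo_isomorphic :: "fo_language \<Rightarrow> 'a fo_structure \<Rightarrow> 'b fo_structure \<Rightarrow> bool" where
  "fo_isomorphic L M N \<longleftrightarrow> (\<exists>h. bij_betw h (domain M) (domain N)
     \<and> (\<forall>r < length (rel_arities L). \<forall>xs \<in> tuples (domain M) (rel_arities L ! r).
          xs \<in> rel_interp M r \<longleftrightarrow> map h xs \<in> rel_interp N r)
     \<and> (\<forall>f < length (fun_arities L). \<forall>xs \<in> tuples (domain M) (fun_arities L ! f).
          h (fun_interp M f xs) = fun_interp N f (map h xs)))"

text \<open>The isomorphism \<open>h\<close> above need not be internal. A structure is internally presented if
  its domain, its relations and the graphs of its functions are internal sets.\<close>

definition internally_presented ::
    "'a sstruct \<Rightarrow> 'b sstruct \<Rightarrow> ('a \<Rightarrow> 'b) \<Rightarrow> fo_language \<Rightarrow> 'b fo_structure \<Rightarrow> bool" where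
  "internally_presented V W star L M \<longleftrightarrow> fo_structure_for L M
   \<and> internal_set V W star (domain M)
   \<and> (\<forall>r < length (rel_arities L). internal_set V W star (tuple_obj W ` rel_interp M r))
   \<and> (\<forall>f < length (fun_arities L). internal_set V W star
        {tuple_obj W (xs @ [fun_interp M f xs]) | xs. xs \<in> tuples (domain M) (fun_arities L ! f)})"

definition isomorphism_property :: "'a sstruct \<Rightarrow> 'b sstruct \<Rightarrow> ('a \<Rightarrow> 'b) \<Rightarrow> bool" where
  "isomorphism_property V W star \<longleftrightarrow>
     (\<forall>L M N. internally_presented V W star L M \<and> internally_presented V W star L N
        \<and> elem_equiv L M N \<longrightarrow> fo_isomorphic L M N)"


section \<open>Generators and nonstandard divisibility\<close>

text \<open>The elements of the nonstandard extension of the positive integers are the atoms of \<open>W\<close>.\<close>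

definition star_set ::
    "'a sstruct \<Rightarrow> (nat \<Rightarrow> 'a) \<Rightarrow> 'b sstruct \<Rightarrow> ('a \<Rightarrow> 'b) \<Rightarrow> nat set \<Rightarrow> 'b set" where
  "star_set V \<nu> W star A = elems W (star (set_obj V (\<nu> ` A)))"

definition tp ::
    "'a sstruct \<Rightarrow> (nat \<Rightarrow> 'a) \<Rightarrow> 'b sstruct \<Rightarrow> ('a \<Rightarrow> 'b) \<Rightarrow> 'b \<Rightarrow> nat set set" where
  "tp V \<nu> W star x = {A. A \<subseteq> pos_nats \<and> x \<in> star_set V \<nu> W star A}"

definition generator ::
    "'a sstruct \<Rightarrow> (nat \<Rightarrow> 'a) \<Rightarrow> 'b sstruct \<Rightarrow> ('a \<Rightarrow> 'b) \<Rightarrow> nat set set \<Rightarrow> 'b \<Rightarrow> bool" where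
  "generator V \<nu> W star F x \<longleftrightarrow> x \<in> star_set V \<nu> W star pos_nats \<and> tp V \<nu> W star x = F"

definition star_dvd ::
    "'a sstruct \<Rightarrow> (nat \<Rightarrow> 'a) \<Rightarrow> 'b sstruct \<Rightarrow> ('a \<Rightarrow> 'b) \<Rightarrow> 'b \<Rightarrow> 'b \<Rightarrow> bool" where
  "star_dvd V \<nu> W star x y \<longleftrightarrow>
     pair_obj W x y \<in> elems W (star (set_obj V
       {pair_obj V (\<nu> m) (\<nu> n) | m n. m \<in> pos_nats \<and> n \<in> pos_nats \<and> m dvd n}))"

end

theory Submission
  imports Defs "HOL-Analysis.Abstract_Topology_2" "HOL-Computational_Algebra.Primes"
begin

text \<open>Conditions (ii) and (iii) are exchanged by transfer and saturation. If \<open>F\<close> contains an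
  antichain \<open>A\<close>, then every \<open>B \<subseteq> A\<close> is the intersection of \<open>A\<close> with an upward closed set, so the
  upward closed members of \<open>F\<close> determine \<open>F\<close>. Conversely, colour the integers by the parity of the
  number \<open>\<Omega>\<close> of their prime factors, and let \<open>A \<in> F\<close> be monochromatic. A convex subset of \<open>A\<close>
  is an antichain, because between \<open>a\<close> and a proper multiple of \<open>a\<close> there is an \<open>a p\<close> with \<open>p\<close> prime.
  Hence if \<open>F\<close> contains no antichain, no convex member of \<open>F\<close> is contained in \<open>A\<close>, and an
  ultrafilter containing the complement of \<open>A\<close> and all convex members of \<open>F\<close> is equivalent to,
  and distinct from, \<open>F\<close>.\<close>

section \<open>Superstructures and transfer\<close>

lemma elems_atoms: "superstructure V \<Longrightarrow> x \<in> atoms V \<Longrightarrow> elems V x = {}"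
  unfolding superstructure_def by (elim conjE) (rule bspec)

lemma inj_on_elems: "superstructure V \<Longrightarrow> inj_on (elems V) (sets_of V)"
  unfolding superstructure_def by (elim conjE)

lemma elems_level:
  assumes "superstructure V" "x \<in> level V n"
  shows "elems V x \<subseteq> level V n"
  using assms(2)
proof (induction n)
  case 0
  then show ?case using elems_atoms[OF assms(1)] by auto
next
  case (Suc n)
  then show ?case by auto
qed

lemma elems_objects:
  "superstructure V \<Longrightarrow> x \<in> objects V \<Longrightarrow> elems V x \<subseteq> objects V"
  unfolding objects_def using elems_level[of V x] by (metis UN_iff UNIV_I subset_iff)

lemma sets_of_objects: "s \<in> sets_of V \<Longrightarrow> s \<in> objects V"
  by (simp add: sets_of_def)

lemma nonempty_sets_of:
  assumes "superstructure V" "s \<in> objects V" "elems V s \<noteq> {}"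
  shows "s \<in> sets_of V"
  using assms elems_atoms[of V s] unfolding sets_of_def by auto

lemma set_obj_elems:
  assumes "superstructure V" "s \<in> sets_of V"
  shows "set_obj V (elems V s) = s"
  unfolding set_obj_def
  using assms(2) inj_on_elems[OF assms(1)] by (intro the_equality) (auto simp: inj_on_def)

text \<open>Fullness of the levels supplies an object with these elements, and extensionality makes
  it the one chosen by \<open>THE\<close>. The level bound allows the construction to be nested, as
  pairs require.\<close>

lemma set_obj:
  assumes V: "superstructure V" and S: "S \<subseteq> level V n"
  shows "set_obj V S \<in> sets_of V" "elems V (set_obj V S) = S" "set_obj V S \<in> level V (Suc n)"
proof -
  obtain s where s: "s \<notin> atoms V" "elems V s = S"
    using V S unfolding superstructure_def by (elim conjE) meson
  then have l: "s \<in> level V (Suc n)" using S by simp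
  then have o: "s \<in> sets_of V" using s unfolding sets_of_def objects_def by blast
  have "set_obj V S = s" using set_obj_elems[OF V o] s by simp
  then show "set_obj V S \<in> sets_of V" "elems V (set_obj V S) = S" "set_obj V S \<in> level V (Suc n)"
    using s l o by simp_all
qed

lemma pair_obj:
  assumes V: "superstructure V" and x: "x \<in> atoms V" and y: "y \<in> atoms V"
  shows "elems V (set_obj V {x}) = {x}" "elems V (set_obj V {x, y}) = {x, y}"
    "elems V (pair_obj V x y) = {set_obj V {x}, set_obj V {x, y}}"
    "pair_obj V x y \<in> level V 2"
proof -
  have a: "{x} \<subseteq> level V 0" "{x, y} \<subseteq> level V 0" using x y by auto
  note s = set_obj[OF V a(1)] set_obj[OF V a(2)]
  then show "elems V (set_obj V {x}) = {x}" "elems V (set_obj V {x, y}) = {x, y}" by simp_all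
  have b: "{set_obj V {x}, set_obj V {x, y}} \<subseteq> level V (Suc 0)" using s by blast
  note p = set_obj[OF V b]
  then show "elems V (pair_obj V x y) = {set_obj V {x}, set_obj V {x, y}}"
    "pair_obj V x y \<in> level V 2" unfolding pair_obj_def numeral_2_eq_2 by blast+
qed

lemma pair_obj_inject:
  assumes V: "superstructure V"
    and at: "x \<in> atoms V" "y \<in> atoms V" "u \<in> atoms V" "v \<in> atoms V"
    and eq: "pair_obj V x y = pair_obj V u v"
  shows "x = u \<and> y = v"
proof -
  \<comment> \<open>Taking elements twice turns the coded pairs into Kuratowski pairs of HOL
    sets.\<close>
  have "elems V ` elems V (pair_obj V x y) = elems V ` elems V (pair_obj V u v)"
    using eq by simp
  then have "{{x}, {x, y}} = {{u}, {u, v}}"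
    using at by (simp add: pair_obj[OF V])
  then show ?thesis by (auto simp: doubleton_eq_iff)
qed

section \<open>Ordered pairs in bounded formulas\<close>

abbreviation BEx :: "nat \<Rightarrow> nat \<Rightarrow> bformula \<Rightarrow> bformula" where
  "BEx i j \<phi> \<equiv> BNeg (BAll i j (BNeg \<phi>))"

abbreviation BOr :: "bformula \<Rightarrow> bformula \<Rightarrow> bformula" where
  "BOr \<phi> \<psi> \<equiv> BNeg (BConj (BNeg \<phi>) (BNeg \<psi>))"

text \<open>The variables 10, 11, 12 are reserved for the bound ones, so \<open>p\<close>, \<open>x\<close>, \<open>y\<close> must be less than 10.\<close>

definition pair_formula :: "nat \<Rightarrow> nat \<Rightarrow> nat \<Rightarrow> bformula" where
  "pair_formula p x y = BEx 10 p (BEx 11 p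
     (BConj (BAll 12 p (BOr (BEq 12 10) (BEq 12 11)))
     (BConj (BConj (BMem x 10) (BAll 12 10 (BEq 12 x)))
            (BConj (BConj (BMem x 11) (BMem y 11)) (BAll 12 11 (BOr (BEq 12 x) (BEq 12 y)))))))"

text \<open>The freshness bounds keep \<open>p\<close>, \<open>x\<close>, \<open>y\<close> intact
  when the bound variables are updated. Since any superstructure is allowed, the same reading of the
  formula serves in \<open>V\<close> and in \<open>W\<close>, on both sides of transfer.\<close>

lemma bsat_pair_formula:
  assumes V: "superstructure V" and fresh: "p < 10" "x < 10" "y < 10"
    and e: "e p \<in> objects V" "e x \<in> atoms V" "e y \<in> atoms V"
  shows "bsat V (pair_formula p x y) e \<longleftrightarrow> e p = pair_obj V (e x) (e y)"
proof -
  have "bsat V (pair_formula p x y) e \<longleftrightarrow>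
    (\<exists>s\<in>elems V (e p). \<exists>t\<in>elems V (e p). (\<forall>z\<in>elems V (e p). z = s \<or> z = t)
      \<and> (e x \<in> elems V s \<and> (\<forall>z\<in>elems V s. z = e x))
      \<and> (e x \<in> elems V t \<and> e y \<in> elems V t) \<and> (\<forall>z\<in>elems V t. z = e x \<or> z = e y))"
    using fresh by (simp add: pair_formula_def) blast
  also have "\<dots> \<longleftrightarrow> (\<exists>s t. elems V (e p) = {s, t} \<and> elems V s = {e x} \<and> elems V t = {e x, e y})"
    (is "?L \<longleftrightarrow> ?R")
  proof
    assume ?L
    then obtain s t where st: "s\<in>elems V (e p)" "t\<in>elems V (e p)"
      "\<forall>z\<in>elems V (e p). z = s \<or> z = t" "e x \<in> elems V s" "\<forall>z\<in>elems V s. z = e x"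
      "e x \<in> elems V t" "e y \<in> elems V t" "\<forall>z\<in>elems V t. z = e x \<or> z = e y" by blast
    have "elems V (e p) = {s, t}" using st by blast
    moreover have "elems V s = {e x}" using st by blast
    moreover have "elems V t = {e x, e y}" using st by blast
    ultimately show ?R by blast
  next
    assume ?R
    then obtain s t where "elems V (e p) = {s, t}" "elems V s = {e x}" "elems V t = {e x, e y}"
      by blast
    then show ?L by (intro bexI[of _ s] bexI[of _ t]) auto
  qed
  also have "\<dots> \<longleftrightarrow> e p = pair_obj V (e x) (e y)"
  proof
    assume ?R
    then obtain s t where st: "elems V (e p) = {s, t}" "elems V s = {e x}" "elems V t = {e x, e y}"
      by blast
    have ob: "s \<in> objects V" "t \<in> objects V"
      using elems_objects[OF V e(1)] st by auto
    \<comment> \<open>Atoms have no elements, so these three objects are sets and are recovered from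
      their elements.\<close>
    have "s \<in> sets_of V" "t \<in> sets_of V" "e p \<in> sets_of V"
      using nonempty_sets_of[OF V] ob e(1) st by auto
    from this[THEN set_obj_elems[OF V]] show "e p = pair_obj V (e x) (e y)"
      using st by (simp add: pair_obj_def)
  next
    assume "e p = pair_obj V (e x) (e y)"
    then show ?R using pair_obj[OF V e(2,3)] by auto
  qed
  finally show ?thesis .
qed

section \<open>Transfer for a nonstandard extension\<close>

locale extension =
  fixes V :: "'a sstruct" and \<nu> :: "nat \<Rightarrow> 'a"
    and W :: "'b sstruct" and star :: "'a \<Rightarrow> 'b"
  assumes ext: "nonstandard_extension V \<nu> W star"
begin

lemma V: "superstructure V" and W: "superstructure W"
  and inj: "inj_on \<nu> pos_nats" and atoms_V: "atoms V = \<nu> ` pos_nats"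
  and star_atoms: "elems W (star (set_obj V (atoms V))) = atoms W"
  using ext unfolding nonstandard_extension_def by - (elim conjE, assumption)+

lemma star_objects: "x \<in> objects V \<Longrightarrow> star x \<in> objects W"
  using ext unfolding nonstandard_extension_def image_subset_iff by (elim conjE) (rule bspec)

lemma transfer: "range e \<subseteq> objects V \<Longrightarrow> bsat V \<phi> e \<longleftrightarrow> bsat W \<phi> (star \<circ> e)"
  using ext unfolding nonstandard_extension_def by (elim conjE) simp

text \<open>In the formulas transferred below, 5, 6 and 7 are the free variables.\<close>

lemma transfer3:
  assumes "a \<in> objects V" "b \<in> objects V" "c \<in> objects V"
  shows "bsat V \<phi> ((\<lambda>_. a)(6 := b, 7 := c)) \<longleftrightarrow>
    bsat W \<phi> ((\<lambda>_. star a)(6 := star b, 7 := star c))"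
proof -
  have "star \<circ> ((\<lambda>_. a)(6::nat := b, 7 := c)) = (\<lambda>_. star a)(6 := star b, 7 := star c)"
    by (auto simp: fun_eq_iff)
  then show ?thesis
    using transfer[of "(\<lambda>_. a)(6 := b, 7 := c)" \<phi>] assms by (auto simp: image_subset_iff)
qed

text \<open>Not restricted to sets of atoms like \<open>star_set\<close>, because sets of coded
  pairs, which live in level 2, are extended as well.\<close>

definition ext_set :: "'a set \<Rightarrow> 'b set" where
  "ext_set S = elems W (star (set_obj V S))"

lemma ext_set_objects:
  assumes "S \<subseteq> level V n"
  shows "ext_set S \<subseteq> objects W"
  unfolding ext_set_def
  by (intro elems_objects W star_objects sets_of_objects set_obj(1)[OF V assms])

text \<open>Difference is expressed by two bounded inclusions. It is the only Boolean operation that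
  is transferred directly: the empty set, intersections and monotonicity are derived from
  it.\<close>

lemma ext_set_Diff:
  assumes S: "S \<subseteq> level V n" and T: "T \<subseteq> level V n"
  shows "ext_set (S - T) = ext_set S - ext_set T"
proof -
  define \<phi> where "\<phi> = BConj (BAll 0 5 (BConj (BMem 0 6) (BNeg (BMem 0 7))))
    (BAll 0 6 (BOr (BMem 0 7) (BMem 0 5)))"
  have D: "S - T \<subseteq> level V n" using S by auto
  note o = set_obj[OF V S] set_obj[OF V T] set_obj[OF V D]
  have "bsat V \<phi> ((\<lambda>_. set_obj V (S - T))(6 := set_obj V S, 7 := set_obj V T))"
    by (simp add: \<phi>_def o)
  then have "bsat W \<phi> ((\<lambda>_. star (set_obj V (S - T)))(6 := star (set_obj V S), 7 := star (set_obj V T)))"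
    using o by (simp only: transfer3 sets_of_objects)
  then show ?thesis by (auto simp: \<phi>_def ext_set_def)
qed

lemma ext_set_empty: "ext_set {} = {}"
  using ext_set_Diff[of "{}" 0 "{}"] by simp

lemma ext_set_Int:
  assumes S: "S \<subseteq> level V n" and T: "T \<subseteq> level V n"
  shows "ext_set (S \<inter> T) = ext_set S \<inter> ext_set T"
proof -
  have "ext_set (S - (S - T)) = ext_set S - ext_set (S - T)"
    using S by (intro ext_set_Diff) auto
  moreover have "S - (S - T) = S \<inter> T" by auto
  ultimately show ?thesis using ext_set_Diff[OF S T] by auto
qed

lemma ext_set_mono:
  assumes "S \<subseteq> T" "T \<subseteq> level V n"
  shows "ext_set S \<subseteq> ext_set T"
  using ext_set_Int[of S n T] assms by (auto simp: Int_absorb2)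

lemma ext_set_nonempty:
  assumes S: "S \<subseteq> level V n" "S \<noteq> {}"
  shows "ext_set S \<noteq> {}"
proof -
  note o = set_obj[OF V S(1)]
  have "bsat V (BEx 0 5 (BEq 0 0)) ((\<lambda>_. set_obj V S)(6 := set_obj V S, 7 := set_obj V S))"
    using o S by simp
  then have "bsat W (BEx 0 5 (BEq 0 0))
      ((\<lambda>_. star (set_obj V S))(6 := star (set_obj V S), 7 := star (set_obj V S)))"
    using o by (simp only: transfer3 sets_of_objects)
  then show ?thesis by (simp add: ext_set_def)
qed

text \<open>Transferring that \<open>S\<close> is an element of its singleton puts its star into the
  star of a set, which is internality. Nonemptiness shows that this star is not an atom.\<close>

lemma internal_ext_set:
  assumes S: "S \<subseteq> level V n" "S \<noteq> {}"
  shows "internal_set V W star (ext_set S)"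
proof -
  let ?s = "set_obj V S"
  note o = set_obj[OF V S(1)]
  have l: "{?s} \<subseteq> level V (Suc n)" using o by simp
  note t = set_obj[OF V l]
  have "bsat V (BMem 6 5) ((\<lambda>_. set_obj V {?s})(6 := ?s, 7 := ?s))"
    using t by simp
  then have "bsat W (BMem 6 5) ((\<lambda>_. star (set_obj V {?s}))(6 := star ?s, 7 := star ?s))"
    using t o by (simp only: transfer3 sets_of_objects)
  then have "star ?s \<in> elems W (star (set_obj V {?s}))"
    by simp
  then have "internal V W star (star ?s)"
    unfolding internal_def using sets_of_objects[OF t(1)] by (rule bexI)
  moreover have "star ?s \<in> sets_of W"
    using nonempty_sets_of[OF W star_objects[OF sets_of_objects[OF o(1)]]] ext_set_nonempty[OF S]
    by (simp add: ext_set_def)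
  ultimately show ?thesis unfolding internal_set_def ext_set_def by blast
qed

text \<open>A family indexed by sets of naturals has at most continuum many members, and closure of
  \<open>G\<close> under intersection with monotonicity of \<open>f\<close> yields the finite
  intersection property. The map \<open>f\<close> is later either the image under
  \<open>\<nu>\<close> or \<open>proper_dvd_pairs\<close>.\<close>

lemma saturation:
  fixes f :: "nat set \<Rightarrow> 'a set"
  assumes sat: "c_plus_saturated V W star"
    and G: "G \<noteq> {}" "\<And>A B. A \<in> G \<Longrightarrow> B \<in> G \<Longrightarrow> A \<inter> B \<in> G"
    and f: "\<And>A. A \<in> G \<Longrightarrow> f A \<subseteq> level V n" "\<And>A. A \<in> G \<Longrightarrow> f A \<noteq> {}" "mono f"
  shows "\<exists>p. \<forall>A\<in>G. p \<in> ext_set (f A)"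
proof -
  let ?S = "(\<lambda>A. ext_set (f A)) ` G"
  have "?S \<lesssim> G" by (rule image_lepoll)
  also have "G \<lesssim> (UNIV :: nat set set)" by (simp add: subset_imp_lepoll)
  also have "\<dots> \<approx> (UNIV :: real set)" by (rule nat_sets_eqpoll_reals)
  finally have card: "?S \<lesssim> (UNIV :: real set)" .
  \<comment> \<open>Finite subfamilies have a lower bound inside \<open>G\<close>; for the empty one
    this is where \<open>G\<close> must be nonempty.\<close>
  have lower: "\<exists>B\<in>G. \<forall>A\<in>H. B \<subseteq> A" if "finite H" "H \<subseteq> G" for H
    using that
  proof (induction H)
    case empty
    then show ?case using G(1) by auto
  next
    case (insert A H)
    then obtain B where B: "B \<in> G" "\<forall>A\<in>H. B \<subseteq> A" by auto
    then have "A \<inter> B \<in> G" "\<forall>A'\<in>insert A H. A \<inter> B \<subseteq> A'" using insert.prems G(2) by auto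
    then show ?case by blast
  qed
  have fip: "\<Inter>T \<noteq> {}" if T: "T \<subseteq> ?S" "finite T" for T
  proof -
    obtain H where H: "H \<subseteq> G" "finite H" "T = (\<lambda>A. ext_set (f A)) ` H"
      using finite_subset_image[OF T(2,1)] by blast
    obtain B where B: "B \<in> G" "\<forall>A\<in>H. B \<subseteq> A" using lower H by blast
    have "ext_set (f B) \<subseteq> ext_set (f A)" if "A \<in> H" for A
    proof (rule ext_set_mono)
      show "f B \<subseteq> f A" using B that f(3) by (simp add: monoD)
      show "f A \<subseteq> level V n" using f(1) H that by blast
    qed
    then have "ext_set (f B) \<subseteq> \<Inter>T" unfolding H(3) by (rule INF_greatest)
    then show ?thesis using ext_set_nonempty[OF f(1,2)[OF B(1)]] by auto
  qed
  have "\<forall>S\<in>?S. internal_set V W star S"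
    unfolding ball_simps using internal_ext_set[OF f(1,2)] by blast
  moreover have "\<forall>T. T \<subseteq> ?S \<and> finite T \<longrightarrow> \<Inter>T \<noteq> {}"
    by (intro allI impI) (elim conjE, rule fip)
  ultimately have "\<Inter>?S \<noteq> {}"
    using card by (intro sat[unfolded c_plus_saturated_def, THEN spec, THEN mp] conjI)
  then show ?thesis by auto
qed

section \<open>Extensions of sets of numbers, and types\<close>

lemma image_level: "A \<subseteq> pos_nats \<Longrightarrow> \<nu> ` A \<subseteq> level V 0"
  using atoms_V by auto

lemma star_set_eq: "star_set V \<nu> W star A = ext_set (\<nu> ` A)"
  by (simp add: star_set_def ext_set_def)

lemma star_set_pos_nats: "star_set V \<nu> W star pos_nats = atoms W"
  using star_atoms by (simp add: star_set_def atoms_V)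

lemma star_set_Diff:
  assumes "A \<subseteq> pos_nats" "B \<subseteq> pos_nats"
  shows "star_set V \<nu> W star (A - B) = star_set V \<nu> W star A - star_set V \<nu> W star B"
proof -
  have "\<nu> ` (A - B) = \<nu> ` A - \<nu> ` B"
    using assms by (intro inj_on_image_set_diff[OF inj]) auto
  then show ?thesis
    using ext_set_Diff[OF assms[THEN image_level]] by (simp add: star_set_eq)
qed

lemma star_set_Int:
  assumes "A \<subseteq> pos_nats" "B \<subseteq> pos_nats"
  shows "star_set V \<nu> W star (A \<inter> B) = star_set V \<nu> W star A \<inter> star_set V \<nu> W star B"
proof -
  have "\<nu> ` (A \<inter> B) = \<nu> ` A \<inter> \<nu> ` B"
    using assms by (intro inj_on_image_Int[OF inj]) auto
  then show ?thesis
    using ext_set_Int[OF assms[THEN image_level]] by (simp add: star_set_eq)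
qed

lemma star_set_mono:
  assumes "A \<subseteq> B" "B \<subseteq> pos_nats"
  shows "star_set V \<nu> W star A \<subseteq> star_set V \<nu> W star B"
  unfolding star_set_eq by (rule ext_set_mono[OF image_mono[OF assms(1)] image_level[OF assms(2)]])

lemma tp_ultrafilter:
  assumes "x \<in> atoms W"
  shows "tp V \<nu> W star x \<in> ultrafilters"
proof -
  have "{} \<notin> tp V \<nu> W star x" by (simp add: tp_def star_set_eq ext_set_empty)
  then show ?thesis
    unfolding ultrafilters_def tp_def
    using assms star_set_pos_nats star_set_mono star_set_Int star_set_Diff[of pos_nats]
    by auto
qed

lemma generator_in_star_set:
  "generator V \<nu> W star F x \<Longrightarrow> A \<in> F \<Longrightarrow> x \<in> star_set V \<nu> W star A"
  by (auto simp: generator_def tp_def)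

section \<open>Divisibility in the extension\<close>

definition dvd_pairs :: "nat set \<Rightarrow> 'a set" where
  "dvd_pairs A = {pair_obj V (\<nu> m) (\<nu> n) | m n. m \<in> A \<and> n \<in> A \<and> m dvd n}"

text \<open>Emptiness of this set means precisely that \<open>A\<close> is an antichain, so
  saturation applies to these sets when (iii) fails.\<close>

definition proper_dvd_pairs :: "nat set \<Rightarrow> 'a set" where
  "proper_dvd_pairs A = {pair_obj V (\<nu> m) (\<nu> n) | m n. m \<in> A \<and> n \<in> A \<and> m \<noteq> n \<and> m dvd n}"

lemma star_dvd_eq:
  "star_dvd V \<nu> W star x y \<longleftrightarrow> pair_obj W x y \<in> ext_set (dvd_pairs pos_nats)"
  by (simp add: star_dvd_def ext_set_def dvd_pairs_def)

lemma dvd_pairs_level: "A \<subseteq> pos_nats \<Longrightarrow> dvd_pairs A \<subseteq> level V 2"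
  unfolding dvd_pairs_def using pair_obj(4)[OF V] atoms_V by blast

lemma proper_dvd_pairs_level: "A \<subseteq> pos_nats \<Longrightarrow> proper_dvd_pairs A \<subseteq> level V 2"
  unfolding proper_dvd_pairs_def using pair_obj(4)[OF V] atoms_V by blast

text \<open>The antichain property is a bounded statement about \<open>A\<close> and the
  divisibility relation, so it transfers. This gives (iii) implies (ii), as generators of
  \<open>F\<close> lie in the extension of every member of \<open>F\<close>.\<close>

lemma antichain_star_dvd:
  assumes A: "A \<subseteq> pos_nats" "dvd_antichain A"
    and x: "x \<in> star_set V \<nu> W star A" and y: "y \<in> star_set V \<nu> W star A"
    and d: "star_dvd V \<nu> W star x y"
  shows "x = y"
proof -
  let ?D = "dvd_pairs pos_nats"
  \<comment> \<open>Variable 5 is the divisibility relation and 6 is \<open>A\<close>. Bounded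
    formulas have no terms for pairs, so a pair is quantified over as an element of the
    relation.\<close>
  define \<phi> where "\<phi> = BAll 0 5 (BAll 1 6 (BAll 2 6
    (BOr (BNeg (pair_formula 0 1 2)) (BEq 1 2))))"
  have lD: "?D \<subseteq> level V 2" by (simp add: dvd_pairs_level)
  note o = set_obj[OF V lD] set_obj[OF V image_level[OF A(1)]]
  have atV: "\<nu> m \<in> atoms V" if "m \<in> pos_nats" for m using that atoms_V by auto
  have "m = n" if m: "m \<in> A" and n: "n \<in> A" and p: "pair_obj V (\<nu> m) (\<nu> n) \<in> ?D" for m n
  proof -
    obtain m' n' where mn: "pair_obj V (\<nu> m) (\<nu> n) = pair_obj V (\<nu> m') (\<nu> n')"
        "m' \<in> pos_nats" "n' \<in> pos_nats" "m' dvd n'"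
      using p unfolding dvd_pairs_def by blast
    have "\<nu> m = \<nu> m' \<and> \<nu> n = \<nu> n'"
      using pair_obj_inject[OF V _ _ _ _ mn(1)] m n mn A(1) atV by blast
    then have "m = m'" "n = n'" using inj m n mn A(1) by (auto simp: inj_on_def)
    then show ?thesis using A(2) m n mn(4) by (auto simp: dvd_antichain_def)
  qed
  moreover have "?D \<subseteq> objects V" using lD by (auto simp: objects_def)
  ultimately have "bsat V \<phi> ((\<lambda>_. set_obj V ?D)(6 := set_obj V (\<nu> ` A), 7 := set_obj V ?D))"
    using A(1) atV by (auto simp: \<phi>_def o bsat_pair_formula[OF V] subset_iff)
  then have 1: "bsat W \<phi> ((\<lambda>_. star (set_obj V ?D))(6 := star (set_obj V (\<nu> ` A)), 7 := star (set_obj V ?D)))"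
    using o by (simp only: transfer3 sets_of_objects)
  have at: "x \<in> atoms W" "y \<in> atoms W"
    using x y star_set_mono[OF A(1)] star_set_pos_nats by auto
  have p: "pair_obj W x y \<in> ext_set ?D" using d by (simp add: star_dvd_eq)
  then have "pair_obj W x y \<in> objects W" using ext_set_objects[OF lD] by blast
  moreover have "bsat W (BOr (BNeg (pair_formula 0 1 2)) (BEq 1 2))
    ((\<lambda>_. star (set_obj V ?D))(6 := star (set_obj V (\<nu> ` A)), 7 := star (set_obj V ?D),
      0 := pair_obj W x y, 1 := x, 2 := y))"
    using 1 p x y by (simp add: \<phi>_def ext_set_def star_set_def)
  ultimately show ?thesis using at by (simp add: bsat_pair_formula[OF W])
qed

text \<open>Saturation produces a bare object \<open>p\<close> of \<open>W\<close>; transfer of the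
  fact that all members of \<open>proper_dvd_pairs A\<close> are pairs of distinct elements of
  \<open>A\<close> splits it into two nonstandard numbers.\<close>

lemma ext_proper_dvd_pairs:
  assumes A: "A \<subseteq> pos_nats" and p: "p \<in> ext_set (proper_dvd_pairs A)"
  shows "\<exists>x\<in>star_set V \<nu> W star A. \<exists>y\<in>star_set V \<nu> W star A. x \<noteq> y \<and> p = pair_obj W x y"
proof -
  let ?D = "proper_dvd_pairs A"
  define \<phi> where "\<phi> = BAll 0 5 (BEx 1 6 (BEx 2 6
    (BConj (pair_formula 0 1 2) (BNeg (BEq 1 2)))))"
  have lD: "?D \<subseteq> level V 2" using A by (simp add: proper_dvd_pairs_level)
  note o = set_obj[OF V lD] set_obj[OF V image_level[OF A]]
  have atV: "\<nu> m \<in> atoms V" if "m \<in> A" for m using that A atoms_V by auto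
  have "\<exists>m\<in>A. \<exists>n\<in>A. q = pair_obj V (\<nu> m) (\<nu> n) \<and> \<nu> m \<noteq> \<nu> n" if "q \<in> ?D" for q
    using that inj A unfolding proper_dvd_pairs_def inj_on_def by blast
  moreover have "?D \<subseteq> objects V" using lD by (auto simp: objects_def)
  ultimately have "bsat V \<phi> ((\<lambda>_. set_obj V ?D)(6 := set_obj V (\<nu> ` A), 7 := set_obj V ?D))"
    using atV by (simp add: \<phi>_def o bsat_pair_formula[OF V] subset_iff)
  then have 1: "bsat W \<phi> ((\<lambda>_. star (set_obj V ?D))(6 := star (set_obj V (\<nu> ` A)), 7 := star (set_obj V ?D)))"
    using o by (simp only: transfer3 sets_of_objects)
  have p': "p \<in> objects W" using p ext_set_objects[OF lD] by blast
  obtain x y where xy: "x \<in> star_set V \<nu> W star A" "y \<in> star_set V \<nu> W star A"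
    "bsat W (pair_formula 0 1 2)
      ((\<lambda>_. star (set_obj V ?D))(6 := star (set_obj V (\<nu> ` A)), 7 := star (set_obj V ?D),
      0 := p, 1 := x, 2 := y))" "x \<noteq> y"
    using 1 p by (auto simp: \<phi>_def ext_set_def star_set_def)
  have at: "x \<in> atoms W" "y \<in> atoms W"
    using xy star_set_mono[OF A] star_set_pos_nats by auto
  show ?thesis using xy at p' by (auto simp: bsat_pair_formula[OF W])
qed

end

section \<open>Ultrafilters and convex sets\<close>

lemma ultrafilterD:
  assumes "F \<in> ultrafilters"
  shows "A \<in> F \<Longrightarrow> A \<subseteq> pos_nats" "pos_nats \<in> F" "{} \<notin> F"
    "A \<in> F \<Longrightarrow> B \<in> F \<Longrightarrow> A \<inter> B \<in> F"
    "A \<in> F \<Longrightarrow> A \<subseteq> B \<Longrightarrow> B \<subseteq> pos_nats \<Longrightarrow> B \<in> F"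
    "A \<subseteq> pos_nats \<Longrightarrow> A \<in> F \<or> pos_nats - A \<in> F"
  using assms unfolding ultrafilters_def by blast+

lemma ultrafilter_subset_eq:
  assumes F: "F \<in> ultrafilters" and G: "G \<in> ultrafilters" and "F \<subseteq> G"
  shows "F = G"
proof -
  have "A \<in> F" if "A \<in> G" for A
  proof (rule ccontr)
    assume "A \<notin> F"
    then have "pos_nats - A \<in> G"
      using ultrafilterD(1)[OF G that] ultrafilterD(6)[OF F] assms(3) by blast
    then have "A \<inter> (pos_nats - A) \<in> G" using that ultrafilterD(4)[OF G] by blast
    moreover have "A \<inter> (pos_nats - A) = {}" by blast
    ultimately show False using ultrafilterD(3)[OF G] by simp
  qed
  then show ?thesis using assms(3) by blast
qed

section \<open>Upward closed sets and antichains: (iii) implies (i)\<close>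

lemma up_closure_up_set:
  assumes "A \<subseteq> pos_nats" "A \<noteq> {}"
  shows "up_closure A \<in> up_sets" "A \<subseteq> up_closure A"
proof -
  show sub: "A \<subseteq> up_closure A"
    using assms(1) dvd_refl unfolding up_closure_def by blast
  have "up_closure (up_closure A) = up_closure A"
  proof
    show "up_closure (up_closure A) \<subseteq> up_closure A"
      unfolding up_closure_def by (auto dest: dvd_trans)
    show "up_closure A \<subseteq> up_closure (up_closure A)"
      using dvd_refl unfolding up_closure_def by blast
  qed
  then show "up_closure A \<in> up_sets"
    using sub assms(2) unfolding up_sets_def by (auto simp: up_closure_def)
qed

lemma tilde_eq_up_sets:
  "tilde_eq F G \<Longrightarrow> U \<in> up_sets \<Longrightarrow> U \<in> F \<longleftrightarrow> U \<in> G"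
  unfolding tilde_eq_def tilde_dvd_def by blast

text \<open>Going up from a point \<open>m\<close> above some \<open>a\<close> in \<open>A\<close>
  cannot lead back into \<open>A\<close>: a multiple of \<open>m\<close> in \<open>A\<close> would
  equal \<open>a\<close>, and then \<open>m\<close>, squeezed between the two, would be
  \<open>a\<close> as well.\<close>

lemma antichain_up_closure_Diff:
  assumes A: "A \<subseteq> pos_nats" "dvd_antichain A" and ne: "up_closure A - A \<noteq> {}"
  shows "up_closure A - A \<in> up_sets"
proof -
  have up: "n \<in> up_closure A - A" if m: "m \<in> up_closure A - A" "m dvd n" "n \<in> pos_nats" for m n
  proof -
    obtain a where a: "a \<in> A" "a dvd m" using m by (auto simp: up_closure_def)
    have "n \<notin> A"
    proof
      assume n: "n \<in> A"
      have "a dvd n" using a m dvd_trans by blast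
      then have "a = n" using n a A(2) by (auto simp: dvd_antichain_def)
      then have "m = n" using a m by (simp add: dvd_antisym)
      then show False using n m by auto
    qed
    then show ?thesis using a m dvd_trans by (auto simp: up_closure_def)
  qed
  have pos: "up_closure A - A \<subseteq> pos_nats" by (auto simp: up_closure_def)
  have "up_closure (up_closure A - A) = up_closure A - A"
  proof
    show "up_closure (up_closure A - A) \<subseteq> up_closure A - A"
    proof
      fix n assume "n \<in> up_closure (up_closure A - A)"
      then obtain m where "m \<in> up_closure A - A" "m dvd n" "n \<in> pos_nats"
        unfolding up_closure_def[of "up_closure A - A"] by blast
      then show "n \<in> up_closure A - A" by (rule up)
    qed
    show "up_closure A - A \<subseteq> up_closure (up_closure A - A)"
      unfolding up_closure_def[of "up_closure A - A"] using pos dvd_refl by blast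
  qed
  then show ?thesis using ne pos unfolding up_sets_def by simp
qed

lemma antichain_tilde_class:
  assumes F: "F \<in> ultrafilters" and A: "A \<in> F" "dvd_antichain A"
  shows "tilde_class F = {F}"
proof -
  have "F = G" if G: "G \<in> ultrafilters" "tilde_eq F G" for G
  proof -
    note Apos = ultrafilterD(1)[OF F A(1)]
    have upF: "up_closure B \<in> G" if "B \<in> F" for B
    proof -
      have B: "B \<subseteq> pos_nats" "B \<noteq> {}" using that ultrafilterD(1,3)[OF F] by auto
      have "up_closure B \<in> F"
        using up_closure_up_set(2)[OF B] ultrafilterD(5)[OF F that] by (auto simp: up_closure_def)
      then show ?thesis using up_closure_up_set(1)[OF B] tilde_eq_up_sets[OF G(2)] by blast
    qed
    \<comment> \<open>Otherwise \<open>G\<close> contains the upward closed set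
      \<open>up_closure A - A\<close>; then so does \<open>F\<close>, although this set is disjoint
      from \<open>A\<close>.\<close>
    have "A \<in> G"
    proof (rule ccontr)
      assume "A \<notin> G"
      then have "(pos_nats - A) \<inter> up_closure A \<in> G"
        using ultrafilterD(4,6)[OF G(1)] Apos upF[OF A(1)] by blast
      moreover have "(pos_nats - A) \<inter> up_closure A = up_closure A - A"
        by (auto simp: up_closure_def)
      ultimately have D: "up_closure A - A \<in> G" by simp
      then have "up_closure A - A \<in> F"
        using antichain_up_closure_Diff[OF Apos A(2)] ultrafilterD(3)[OF G(1)]
          tilde_eq_up_sets[OF G(2)] by metis
      then have "A \<inter> (up_closure A - A) \<in> F" using A(1) ultrafilterD(4)[OF F] by blast
      moreover have "A \<inter> (up_closure A - A) = {}" by blast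
      ultimately show False using ultrafilterD(3)[OF F] by simp
    qed
    have "B \<in> G" if B: "B \<in> F" for B
    proof -
      let ?C = "A \<inter> B"
      have C: "?C \<in> F" using A(1) B ultrafilterD(4)[OF F] by blast
      \<comment> \<open>An element of \<open>A\<close> above an element of
        \<open>A \<inter> B\<close> is equal to it, so this trace on \<open>A\<close> stays inside
        \<open>B\<close>.\<close>
      have "A \<inter> up_closure ?C \<in> G"
        using \<open>A \<in> G\<close> upF[OF C] ultrafilterD(4)[OF G(1)] by blast
      moreover have "A \<inter> up_closure ?C \<subseteq> B"
        using A(2) by (auto simp: up_closure_def dvd_antichain_def)
      ultimately show ?thesis
        using ultrafilterD(5)[OF G(1)] ultrafilterD(1)[OF F B] by blast
    qed
    then show ?thesis using ultrafilter_subset_eq[OF F G(1)] by blast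
  qed
  moreover have "tilde_eq F F" by (auto simp: tilde_eq_def tilde_dvd_def)
  ultimately show ?thesis using F by (auto simp: tilde_class_def)
qed

section \<open>Sets convex for divisibility\<close>

definition dvd_convex :: "nat set \<Rightarrow> bool" where
  "dvd_convex C \<longleftrightarrow> (\<forall>a\<in>C. \<forall>c\<in>C. \<forall>b. a dvd b \<and> b dvd c \<longrightarrow> b \<in> C)"

lemma dvd_convex_Int: "dvd_convex C \<Longrightarrow> dvd_convex D \<Longrightarrow> dvd_convex (C \<inter> D)"
  unfolding dvd_convex_def by blast

lemma dvd_pos_nats: "m dvd n \<Longrightarrow> n \<in> pos_nats \<Longrightarrow> m \<in> pos_nats"
  using dvd_pos_nat[of n m] by (auto simp: pos_nats_def Suc_le_eq)

lemma dvd_convex_pos_nats: "dvd_convex pos_nats"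
  unfolding dvd_convex_def using dvd_pos_nats by blast

text \<open>Because both an upward closed set and its complement are convex, an ultrafilter
  containing all convex members of \<open>F\<close> agrees with \<open>F\<close> on
  \<open>up_sets\<close>.\<close>

lemma up_set_convex:
  assumes "U \<in> up_sets"
  shows "dvd_convex U" "dvd_convex (pos_nats - U)"
proof -
  have U: "n \<in> U" if "m \<in> U" "m dvd n" "n \<in> pos_nats" for m n
    using assms that unfolding up_sets_def up_closure_def by blast
  have "U \<subseteq> pos_nats" using assms by (auto simp: up_sets_def)
  then show "dvd_convex U" "dvd_convex (pos_nats - U)"
    unfolding dvd_convex_def using U dvd_pos_nats by blast+
qed

text \<open>If \<open>a\<close> properly divides \<open>b\<close>, take a prime \<open>p\<close>
  dividing the quotient: \<open>a * p\<close> lies between them, hence in \<open>C\<close>, but has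
  one more prime factor than \<open>a\<close>. The boolean \<open>e\<close> treats both parities at
  once.\<close>

lemma convex_antichain:
  assumes C: "C \<subseteq> pos_nats" "dvd_convex C"
    and parity: "\<And>c. c \<in> C \<Longrightarrow> even (size (prime_factorization c)) = e"
  shows "dvd_antichain C"
proof -
  have False if ab: "a \<in> C" "b \<in> C" "a \<noteq> b" "a dvd b" for a b
  proof -
    obtain k where k: "b = a * k" using ab(4) by blast
    have "k \<noteq> 1" using k ab(3) by auto
    then obtain p where p: "prime p" "p dvd k" using prime_factor_nat by blast
    have "a * p \<in> C"
      using C(2) ab p(2) k unfolding dvd_convex_def by (meson dvd_triv_left mult_dvd_mono dvd_refl)
    \<comment> \<open>Factorizations add up only for nonzero factors, since
      \<open>prime_factorization 0\<close> is empty by convention.\<close>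
    moreover have "a \<noteq> 0" using C(1) ab(1) by (auto simp: pos_nats_def)
    moreover have "p \<noteq> 0" using p(1) by (auto simp: prime_gt_0_nat)
    ultimately show False
      using parity[of "a * p"] parity[OF ab(1)] p(1)
      by (simp add: prime_factorization_mult prime_factorization_prime)
  qed
  then show ?thesis unfolding dvd_antichain_def by blast
qed

text \<open>The second ultrafilter in the class is obtained as the type of a point \<open>x\<close>
  supplied by saturation.\<close>

lemma (in extension) singleton_imp_antichain:
  assumes sat: "c_plus_saturated V W star" and F: "F \<in> ultrafilters"
    and single: "is_singleton (tilde_class F)"
  shows "\<exists>A\<in>F. dvd_antichain A"
proof (rule ccontr)
  assume no: "\<not> (\<exists>A\<in>F. dvd_antichain A)"
  let ?E = "{n \<in> pos_nats. even (size (prime_factorization n))}"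
  obtain A e where A: "A \<in> F" and e: "\<And>c. c \<in> A \<Longrightarrow> even (size (prime_factorization c)) = e"
  proof -
    have "?E \<in> F \<or> pos_nats - ?E \<in> F" by (rule ultrafilterD(6)[OF F]) auto
    then show ?thesis
    proof
      assume "?E \<in> F"
      then show ?thesis by (rule that[of _ True]) simp
    next
      assume "pos_nats - ?E \<in> F"
      then show ?thesis by (rule that[of _ False]) simp
    qed
  qed
  note Fpos = ultrafilterD(1)[OF F]
  \<comment> \<open>A point in the extensions of all these sets lies in that of every convex member
    of \<open>F\<close> and, by the case \<open>C = pos_nats\<close>, outside that of
    \<open>A\<close>.\<close>
  let ?G = "(\<lambda>C. C - A) ` {C \<in> F. dvd_convex C}"
  have ne: "?G \<noteq> {}" using ultrafilterD(2)[OF F] dvd_convex_pos_nats by auto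
  have Int: "B \<inter> B' \<in> ?G" if B: "B \<in> ?G" and B': "B' \<in> ?G" for B B'
  proof -
    obtain C where C: "B = C - A" "C \<in> F" "dvd_convex C" using B by auto
    obtain D where D: "B' = D - A" "D \<in> F" "dvd_convex D" using B' by auto
    have "B \<inter> B' = C \<inter> D - A" using C(1) D(1) by auto
    moreover have "C \<inter> D \<in> {C \<in> F. dvd_convex C}"
      using C D ultrafilterD(4)[OF F] dvd_convex_Int by simp
    ultimately show ?thesis by (rule image_eqI)
  qed
  have level: "\<nu> ` B \<subseteq> level V 0" if B: "B \<in> ?G" for B
    using B Fpos by (intro image_level) auto
  \<comment> \<open>If \<open>C - A\<close> were empty, the convex set \<open>C\<close> would have
    constant parity and be an antichain in \<open>F\<close>.\<close>
  have image: "\<nu> ` B \<noteq> {}" if B: "B \<in> ?G" for B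
  proof
    assume "\<nu> ` B = {}"
    moreover obtain C where "B = C - A" "C \<in> F" "dvd_convex C" using B by auto
    ultimately have C: "C \<in> F" "dvd_convex C" "C \<subseteq> A" by simp_all
    have "dvd_antichain C"
      by (rule convex_antichain[OF Fpos[OF C(1)] C(2) e[OF subsetD[OF C(3)]]])
    then show False using no C by blast
  qed
  have "mono ((`) \<nu>)" by (auto simp: mono_def)
  from saturation[OF sat ne Int level image this]
  have "\<exists>x. \<forall>B\<in>?G. x \<in> ext_set (\<nu> ` B)" .
  then obtain x where "\<forall>B\<in>?G. x \<in> ext_set (\<nu> ` B)" ..
  then have x: "x \<in> star_set V \<nu> W star (C - A)" if "C \<in> F" "dvd_convex C" for C
    unfolding star_set_eq using that by blast
  have xC: "x \<in> star_set V \<nu> W star C" if "C \<in> F" "dvd_convex C" for C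
    using x[OF that] star_set_mono[of "C - A" C] Fpos[OF that(1)] by blast
  have xA: "x \<in> atoms W" "x \<notin> star_set V \<nu> W star A"
    using x[OF ultrafilterD(2)[OF F] dvd_convex_pos_nats]
      star_set_Diff[OF order_refl Fpos[OF A]] star_set_pos_nats
    by simp_all
  let ?T = "tp V \<nu> W star x"
  have T: "?T \<in> ultrafilters" using tp_ultrafilter[OF xA(1)] .
  have conv: "C \<in> ?T" if "C \<in> F" "dvd_convex C" for C
    using xC[OF that] Fpos[OF that(1)] by (simp add: tp_def)
  have "U \<in> F \<longleftrightarrow> U \<in> ?T" if U: "U \<in> up_sets" for U
  proof
    show "U \<in> F \<Longrightarrow> U \<in> ?T" using conv up_set_convex(1)[OF U] by blast
    assume UT: "U \<in> ?T"
    show "U \<in> F"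
    proof (rule ccontr)
      assume "U \<notin> F"
      moreover have "U \<subseteq> pos_nats" using U by (auto simp: up_sets_def)
      ultimately have "pos_nats - U \<in> ?T"
        using ultrafilterD(6)[OF F] conv up_set_convex(2)[OF U] by blast
      then have "U \<inter> (pos_nats - U) \<in> ?T" using UT ultrafilterD(4)[OF T] by blast
      moreover have "U \<inter> (pos_nats - U) = {}" by blast
      ultimately show False using ultrafilterD(3)[OF T] by simp
    qed
  qed
  then have "tilde_eq F ?T" by (auto simp: tilde_eq_def tilde_dvd_def)
  moreover have "tilde_eq F F" by (auto simp: tilde_eq_def tilde_dvd_def)
  ultimately have "?T \<in> tilde_class F" "F \<in> tilde_class F"
    using T F by (auto simp: tilde_class_def)
  then have "?T = F" using single by (auto simp: is_singleton_def)
  then show False using A xA(2) by (auto simp: tp_def)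
qed

text \<open>This is the contrapositive of (ii) implies (iii): one coded pair is found in the
  extensions of \<open>proper_dvd_pairs A\<close> for all \<open>A\<close> in \<open>F\<close>
  simultaneously, and its components are the generators.\<close>

lemma (in extension) no_antichain_generators:
  assumes sat: "c_plus_saturated V W star" and F: "F \<in> ultrafilters"
    and no: "\<not> (\<exists>A\<in>F. dvd_antichain A)"
  shows "\<exists>x y. x \<noteq> y \<and> generator V \<nu> W star F x \<and> generator V \<nu> W star F y
    \<and> star_dvd V \<nu> W star x y"
proof -
  note Fpos = ultrafilterD(1)[OF F]
  have "\<exists>p. \<forall>A\<in>F. p \<in> ext_set (proper_dvd_pairs A)"
  proof (rule saturation[OF sat])
    show "F \<noteq> {}" using ultrafilterD(2)[OF F] by blast
    show "\<And>A B. A \<in> F \<Longrightarrow> B \<in> F \<Longrightarrow> A \<inter> B \<in> F" using ultrafilterD(4)[OF F] .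
    show "\<And>A. A \<in> F \<Longrightarrow> proper_dvd_pairs A \<subseteq> level V 2"
      using proper_dvd_pairs_level Fpos by blast
    show "\<And>A. A \<in> F \<Longrightarrow> proper_dvd_pairs A \<noteq> {}"
      using no unfolding proper_dvd_pairs_def dvd_antichain_def by blast
    show "mono proper_dvd_pairs" by (auto simp: mono_def proper_dvd_pairs_def)
  qed
  then obtain p where p: "\<And>A. A \<in> F \<Longrightarrow> p \<in> ext_set (proper_dvd_pairs A)" by blast
  note P = ultrafilterD(2)[OF F]
  obtain x y where xy: "x \<in> atoms W" "y \<in> atoms W" "x \<noteq> y" "p = pair_obj W x y"
    using ext_proper_dvd_pairs[OF _ p[OF P]] star_set_pos_nats by blast
  \<comment> \<open>The components \<open>x\<close>, \<open>y\<close> were read off with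
    \<open>A = pos_nats\<close>. Every other \<open>A\<close> gives its own decomposition of
    \<open>p\<close>, which is the same one by injectivity of pairing.\<close>
  have in_star: "x \<in> star_set V \<nu> W star A \<and> y \<in> star_set V \<nu> W star A" if A: "A \<in> F" for A
  proof -
    obtain u v where uv: "u \<in> star_set V \<nu> W star A" "v \<in> star_set V \<nu> W star A" "p = pair_obj W u v"
      using ext_proper_dvd_pairs[OF Fpos[OF A] p[OF A]] by blast
    then have "u \<in> atoms W" "v \<in> atoms W"
      using star_set_mono[OF Fpos[OF A]] star_set_pos_nats by auto
    then have "x = u \<and> y = v" using pair_obj_inject[OF W xy(1,2), of u v] uv(3) xy(4) by simp
    then show ?thesis using uv by blast
  qed
  have gen: "generator V \<nu> W star F z"
    if "z \<in> atoms W" "\<And>A. A \<in> F \<Longrightarrow> z \<in> star_set V \<nu> W star A" for z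
  proof -
    have "F \<subseteq> tp V \<nu> W star z" using that(2) Fpos by (auto simp: tp_def)
    then have "F = tp V \<nu> W star z"
      using ultrafilter_subset_eq[OF F tp_ultrafilter[OF that(1)]] by blast
    then show ?thesis using that(1) by (simp add: generator_def star_set_pos_nats)
  qed
  have "proper_dvd_pairs pos_nats \<subseteq> dvd_pairs pos_nats"
    unfolding proper_dvd_pairs_def dvd_pairs_def by blast
  then have "star_dvd V \<nu> W star x y"
    using p[OF P] ext_set_mono[OF _ dvd_pairs_level[of pos_nats]] xy(4)
    unfolding star_dvd_eq by blast
  then show ?thesis using xy gen in_star by blast
qed

theorem theorem5p1:
  fixes V :: "'a sstruct" and \<nu> :: "nat \<Rightarrow> 'a"
    and W :: "'b sstruct" and star :: "'a \<Rightarrow> 'b"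
    and F :: "nat set set"
  assumes "nonstandard_extension V \<nu> W star"
    and "c_plus_saturated V W star"
    and "isomorphism_property V W star"
    and "F \<in> ultrafilters"
  shows "(is_singleton (tilde_class F) \<longleftrightarrow>
           \<not> (\<exists>x y. x \<noteq> y \<and> generator V \<nu> W star F x \<and> generator V \<nu> W star F y
                \<and> star_dvd V \<nu> W star x y))
       \<and> (\<not> (\<exists>x y. x \<noteq> y \<and> generator V \<nu> W star F x \<and> generator V \<nu> W star F y
                \<and> star_dvd V \<nu> W star x y) \<longleftrightarrow>
           (\<exists>A\<in>F. dvd_antichain A))"
proof -
  interpret extension V \<nu> W star by unfold_locales fact
  \<comment> \<open>Conditions (i) and (ii) are each compared with (iii).\<close>
  have "is_singleton (tilde_class F) \<longleftrightarrow> (\<exists>A\<in>F. dvd_antichain A)"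
    using singleton_imp_antichain[OF assms(2,4)] antichain_tilde_class[OF assms(4)]
    by (auto simp: is_singleton_def)
  moreover have "\<not> (\<exists>x y. x \<noteq> y \<and> generator V \<nu> W star F x \<and> generator V \<nu> W star F y
      \<and> star_dvd V \<nu> W star x y) \<longleftrightarrow> (\<exists>A\<in>F. dvd_antichain A)"
    using no_antichain_generators[OF assms(2,4)]
      antichain_star_dvd[OF ultrafilterD(1)[OF assms(4)]] generator_in_star_set by blast
  ultimately show ?thesis by blast
qed

end
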